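(* Let $(A,\omega)$ be a commutative (not necessarily associative) baric $K$-algebra satisfying $2x^{2}x^{4}=\omega(x)^{2}x^{4}+\omega(x)^{4}x^{2}$ for all $x\in A$, and let $e$ be a non-zero idempotent of $A$. Then $A$ admits a Peirce decomposition relative to $e$: $$A=Ke\oplus A_0\oplus A_{\frac12}\oplus A_{\lambda}\oplus A_{\bar\lambda},$$ where $A_{\alpha}=\{x\in \ker\omega : ex=\alpha x\}$ for $\alpha\in\{0,\tfrac12,\lambda,\bar\lambda\}$, with $\lambda=\frac{-1-i\sqrt{23}}{4}$ and $\bar\lambda=\frac{-1+i\sqrt{23}}{4}$.
   Context: $K$ is an algebraically closed (infinite, commutative) field of characteristic different from $2$. $i\sqrt{23}$ denotes a fixed square root of $-23$ in $K$. Algebras are commutative but not necessarily associative. A baric $K$-algebra $(A,\omega)$ is a $K$-algebra $A$ with a non-zero algebra homomorphism $\omega:A\to K$ (weight function). Principal powers are $x^1=x$, $x^{k+1}=x\,x^{k}$.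
   Formalization: The field K is additionally assumed to have characteristic different from 3 and 23; in these characteristics 0, 1/2, λ, λ̄ are not pairwise distinct and the stated decomposition fails in general. *)

theory Defs
  imports "HOL-Computational_Algebra.Computational_Algebra"
begin

text \<open>
  The underlying vector space of the algebra is the whole type \<open>'a\<close>, with scalar multiplication
  \<open>scale\<close>. The product \<open>mul\<close> is not assumed to be associative. Linearity in the second argument
  together with commutativity makes it bilinear.
\<close>

locale baric_algebra = vector_space scale
  for scale :: "'k::field \<Rightarrow> 'a::ab_group_add \<Rightarrow> 'a" +
  fixes mul :: "'a \<Rightarrow> 'a \<Rightarrow> 'a" and weight :: "'a \<Rightarrow> 'k"
  assumes mul_commute: "mul x y = mul y x"
    and mul_linear: "Vector_Spaces.linear scale scale (mul x)"
    and weight_linear: "Vector_Spaces.linear scale (*) weight"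
    and weight_mul: "weight (mul x y) = weight x * weight y"
    and weight_nonzero: "\<exists>x. weight x \<noteq> 0"

text \<open>
  Only exponents \<open>k \<ge> 1\<close> are meaningful, as there need not be a unit; the value at exponent 0
  is the junk value \<open>x\<close>.
\<close>

definition principal_power :: "('a \<Rightarrow> 'a \<Rightarrow> 'a) \<Rightarrow> 'a \<Rightarrow> nat \<Rightarrow> 'a" where
  "principal_power mul x k = (mul x ^^ (k - 1)) x"

lemma principal_power_1: "principal_power mul x 1 = x"
  by (simp add: principal_power_def)

lemma principal_power_Suc:
  "k \<ge> 1 \<Longrightarrow> principal_power mul x (Suc k) = mul x (principal_power mul x k)"
  by (cases k) (simp_all add: principal_power_def)

text \<open>
  For \<open>y\<close> in the kernel of the weight, linearising the identity at \<open>e\<close> gives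
  \<open>L (2 L - 1) (2 L^2 + L + 3) y = 0\<close> where \<open>L\<close> is multiplication by \<open>e\<close>. Outside characteristic 2
  the four roots are pairwise distinct exactly if the characteristic is neither 3 nor 23. In these
  two characteristics the Peirce decomposition fails in general: take \<open>y * z = 0\<close> on the kernel
  and let \<open>L\<close> act on it as a Jordan block of size 2 for the double root.
\<close>

definition peirce_space ::
    "('k \<Rightarrow> 'a \<Rightarrow> 'a) \<Rightarrow> ('a \<Rightarrow> 'a \<Rightarrow> 'a) \<Rightarrow> ('a \<Rightarrow> 'k::zero) \<Rightarrow> 'a \<Rightarrow> 'k \<Rightarrow> 'a set" where
  "peirce_space scale mul weight e \<alpha> = {x. weight x = 0 \<and> mul e x = scale \<alpha> x}"

text \<open>
  The whole space is the internal direct sum of a list of subspaces. The summands are a list rather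
  than a set, so that a repeated nonzero summand does violate directness.
\<close>

definition (in module) is_direct_sum :: "'b set list \<Rightarrow> bool" where
  "is_direct_sum Vs \<longleftrightarrow>
     (\<forall>V\<in>set Vs. subspace V) \<and> (\<forall>x. \<exists>!vs. list_all2 (\<in>) vs Vs \<and> x = sum_list vs)"

end

theory Submission
  imports Defs
begin

text \<open>
  The whole decomposition comes out of the first-order part of the identity at \<open>e\<close>. An idempotent
  \<open>e \<noteq> 0\<close> has weight 1: its weight is 0 or 1, and weight 0 would turn the identity at \<open>e\<close> into
  \<open>2 e = 0\<close>. So for \<open>y\<close> in the kernel of the weight the elements \<open>e + t y\<close> all have weight 1, and
  on this line the identity is polynomial in \<open>t\<close> with constant coefficients. The field is infinite,
  so the coefficient of \<open>t\<close> must agree on both sides. With \<open>L\<close> for multiplication by \<open>e\<close>, the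
  elements \<open>x\<^sup>2\<close>, \<open>x\<^sup>3\<close>, \<open>x\<^sup>4\<close> have the \<open>t\<close>-coefficients \<open>2 L y\<close>, \<open>(2 L\<^sup>2 + L) y\<close> and
  \<open>(2 L\<^sup>3 + L\<^sup>2 + L) y\<close>, and the comparison reads
  \[ 4 L^4 y + 5 L^2 y - 3 L y = 0 \]
  (lemma \<open>linearized_identity\<close>).
  The polynomial factors as \<open>4 L (L - 1/2) (L - \<lambda>) (L - \<lambda>')\<close>, where \<open>\<lambda>, \<lambda>'\<close> are the roots of
  \<open>2 X\<^sup>2 + X + 3\<close>, and in characteristic other than 2, 3 and 23 its roots are distinct. An operator
  killed by a product of distinct linear factors splits the space into eigenspaces
  (\<open>eigenvectors_span\<close>, \<open>eigenvectors_independent\<close>); here this splits the kernel of the weight. Finally the kernel is complemented by the line through \<open>e\<close>, since the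
  weight of \<open>e\<close> is 1.

  Higher coefficients in \<open>t\<close> are never computed: \<open>has_jet\<close> records a value at 0 and a first-order
  coefficient, and hides the rest in a polynomial remainder.
\<close>

section \<open>Infinitely many scalars\<close>

lemma infinite_UNIV_alg_closed: "infinite (UNIV :: 'k::alg_closed_field set)"
proof
  assume fin: "finite (UNIV :: 'k set)"
  \<comment> \<open>\<open>1 + q\<close> takes the value 1 everywhere, yet is not constant.\<close>
  define q where "q = (\<Prod>a\<in>(UNIV::'k set). [:- a, 1:])"
  have "degree q = (\<Sum>a\<in>(UNIV::'k set). degree [:- a, 1:])"
    unfolding q_def by (rule degree_prod_eq_sum_degree) auto
  then have "degree q = card (UNIV :: 'k set)" by simp
  moreover have "card (UNIV :: 'k set) > 0" using fin by (simp add: card_gt_0_iff)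
  ultimately have "degree (1 + q) > 0"
    by (simp add: degree_add_eq_right)
  then obtain x where "poly (1 + q) x = 0" using alg_closed_imp_poly_has_root by blast
  moreover have "poly q x = 0" using fin by (auto simp: q_def poly_prod)
  ultimately show False by simp
qed

section \<open>Sums of eigenvectors\<close>

text \<open>The difference of two decompositions of a vector decomposes 0, so uniqueness is only checked
  at 0.\<close>
lemma (in module) is_direct_sumI:
  assumes "\<And>V. V \<in> set Vs \<Longrightarrow> subspace V"
    and "\<And>x. \<exists>vs. list_all2 (\<in>) vs Vs \<and> x = sum_list vs"
    and zero: "\<And>vs. list_all2 (\<in>) vs Vs \<Longrightarrow> sum_list vs = 0 \<Longrightarrow> set vs \<subseteq> {0}"
  shows "is_direct_sum Vs"
  unfolding is_direct_sum_def
proof (intro conjI ballI allI ex_ex1I)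
  fix x vs ws
  assume "list_all2 (\<in>) vs Vs \<and> x = sum_list vs" "list_all2 (\<in>) ws Vs \<and> x = sum_list ws"
  then have vs: "list_all2 (\<in>) vs Vs" and ws: "list_all2 (\<in>) ws Vs"
    and sums: "sum_list vs = sum_list ws" by auto
  then have len: "length vs = length ws" by (simp add: list_all2_lengthD)
  let ?d = "map2 (-) vs ws"
  have "list_all2 (\<in>) ?d Vs"
    using vs ws assms(1) by (auto simp: list_all2_conv_all_nth subspace_diff)
  moreover have "sum_list ?d = sum_list vs - sum_list ws"
    using len by (induction vs ws rule: list_induct2) (auto simp: algebra_simps)
  with sums have "sum_list ?d = 0" by simp
  ultimately have d: "set ?d \<subseteq> {0}" by (rule zero)
  show "vs = ws"
  proof (rule nth_equalityI[OF len])
    fix i assume "i < length vs"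
    with len have "vs ! i - ws ! i \<in> set ?d" by (auto simp: set_zip image_iff)
    with d show "vs ! i = ws ! i" by auto
  qed
qed (use assms in auto)

context vector_space
begin

lemma linear_shift:
  assumes "Vector_Spaces.linear scale scale T"
  shows "Vector_Spaces.linear scale scale (\<lambda>v. T v - scale a v)"
  using assms by (simp add: Vector_Spaces.linear_iff algebra_simps)

lemma linear_sum_list:
  assumes "Vector_Spaces.linear scale scale T"
  shows "T (sum_list vs) = sum_list (map T vs)"
proof -
  interpret T: Vector_Spaces.linear scale scale T by fact
  show ?thesis by (induction vs) (simp_all add: T.zero T.add)
qed

text \<open>Applying \<open>T - a\<close> removes the component at \<open>a\<close> and rescales every other one by a nonzero
  scalar, so the remaining components vanish by induction.\<close>
lemma eigenvectors_independent:
  assumes T: "Vector_Spaces.linear scale scale T"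
  shows "distinct as \<Longrightarrow> list_all2 (\<lambda>v a. T v = scale a v) vs as \<Longrightarrow> sum_list vs = 0 \<Longrightarrow> set vs \<subseteq> {0}"
proof (induction as arbitrary: vs)
  case Nil
  then show ?case by simp
next
  case (Cons a as)
  interpret T: Vector_Spaces.linear scale scale T by fact
  from Cons.prems obtain v us where vs: "vs = v # us" and v: "T v = scale a v"
    and us: "list_all2 (\<lambda>v a. T v = scale a v) us as"
    by (auto simp: list_all2_Cons2)
  let ?S = "\<lambda>v. T v - scale a v"
  have "sum_list (map ?S us) = ?S (sum_list us)"
    using linear_sum_list[OF linear_shift[OF T]] by simp
  also have "\<dots> = ?S v + ?S (sum_list us)" using v by simp
  also have "\<dots> = ?S (sum_list vs)" by (simp add: vs T.add algebra_simps)
  also have "\<dots> = 0" using Cons.prems by (simp add: T.zero)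
  finally have sum0: "sum_list (map ?S us) = 0" .
  have eig: "list_all2 (\<lambda>v a. T v = scale a v) (map ?S us) as"
    unfolding list_all2_map1
    by (rule list_all2_mono[OF us]) (simp add: T.diff T.scale scale_right_diff_distrib)
  from Cons.prems(1) have "distinct as" by simp
  from Cons.IH[OF this eig sum0] have S0: "set (map ?S us) \<subseteq> {0}" .
  have "u = 0" if "u \<in> set us" for u
  proof -
    from us that have "\<exists>b\<in>set as. T u = scale b u"
      by (induction us as rule: list_all2_induct) auto
    then obtain b where b: "b \<in> set as" "T u = scale b u" by blast
    have "T u - scale a u = 0" using S0 that by (simp add: image_subset_iff del: right_minus_eq)
    with b have "scale (b - a) u = 0" by (simp only: scale_left_diff_distrib)
    with b Cons.prems show "u = 0" by auto
  qed
  then have us0: "set us \<subseteq> {0}" by blast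
  then have "sum_list us = 0" by (induction us) auto
  with Cons.prems vs have "v = 0" by simp
  with us0 vs show ?case by simp
qed

text \<open>Away from the eigenvalue \<open>a\<close>, the operator \<open>T - a\<close> is inverted on eigenvectors by division
  by the difference of the eigenvalues. This lifts a decomposition of \<open>(T - a) y\<close> to one of \<open>y\<close>,
  up to an eigenvector for \<open>a\<close>.\<close>
lemma eigenvectors_span:
  assumes T: "Vector_Spaces.linear scale scale T"
    and W: "subspace W" "\<And>w. w \<in> W \<Longrightarrow> T w \<in> W"
  shows "distinct as \<Longrightarrow> y \<in> W \<Longrightarrow> fold (\<lambda>a z. T z - scale a z) as y = 0 \<Longrightarrow>
    \<exists>vs. list_all2 (\<lambda>v a. v \<in> W \<and> T v = scale a v) vs as \<and> y = sum_list vs"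
proof (induction as arbitrary: y)
  case Nil
  then show ?case by simp
next
  case (Cons a as)
  interpret T: Vector_Spaces.linear scale scale T by fact
  let ?S = "\<lambda>v. T v - scale a v"
  let ?P = "\<lambda>v a. v \<in> W \<and> T v = scale a v"
  have "?S y \<in> W" using Cons.prems W by (simp add: subspace_diff subspace_scale)
  with Cons obtain zs where zs: "list_all2 ?P zs as" "?S y = sum_list zs" by auto
  from zs(1) Cons.prems(1) have "\<exists>us. list_all2 ?P us as \<and> map ?S us = zs"
  proof (induction zs as rule: list_all2_induct)
    case Nil
    then show ?case by simp
  next
    case (Cons z zs b bs)
    then obtain us where us: "list_all2 ?P us bs" "map ?S us = zs" by auto
    let ?u = "scale (inverse (b - a)) z"
    have u: "?P ?u b" using Cons W by (simp add: subspace_scale T.scale mult.commute)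
    have "?S ?u = scale (inverse (b - a) * (b - a)) z"
      using Cons by (simp add: T.scale algebra_simps)
    moreover have "inverse (b - a) * (b - a) = 1" using Cons.prems by auto
    ultimately have "?S ?u = z" by simp
    with u us show ?case by (intro exI[of _ "?u # us"]) auto
  qed
  then obtain us where us: "list_all2 ?P us as" "map ?S us = zs" by blast
  let ?v = "y - sum_list us"
  have "sum_list us \<in> W"
    using us(1) W by (induction us as rule: list_all2_induct) (auto simp: subspace_0 subspace_add)
  then have "?v \<in> W" using Cons.prems W by (simp add: subspace_diff)
  moreover have "?S (sum_list us) = ?S y"
    using linear_sum_list[OF linear_shift[OF T]] us zs by metis
  then have "?S ?v = 0" by (simp add: T.diff algebra_simps)
  ultimately show ?case using us by (intro exI[of _ "?v # us"]) auto
qed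

lemma functional_nonzero:
  assumes "v \<noteq> 0"
  shows "\<exists>f. Vector_Spaces.linear scale (*) f \<and> f v \<noteq> 0"
proof -
  interpret K: vector_space "(*) :: 'a \<Rightarrow> 'a \<Rightarrow> 'a"
    by unfold_locales (auto simp: algebra_simps)
  interpret P: vector_space_pair scale "(*) :: 'a \<Rightarrow> 'a \<Rightarrow> 'a" ..
  have "independent {v}" using assms by simp
  then obtain f where "Vector_Spaces.linear scale (*) f" "f v = 1"
    using P.linear_independent_extend[of "{v}" "\<lambda>_. 1"] by auto
  then show ?thesis by (intro exI[of _ f]) simp
qed

end

section \<open>Polynomial maps and first-order coefficients\<close>

context baric_algebra
begin

text \<open>Polynomial maps from the scalars into the algebra. The generation rules give inductions
  for products and for functionals, without any bookkeeping of degrees and coefficients.\<close>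
inductive poly_map :: "('k \<Rightarrow> 'a) \<Rightarrow> bool" where
  const: "poly_map (\<lambda>t. v)"
| shift: "poly_map F \<Longrightarrow> poly_map (\<lambda>t. scale t (F t))"
| add: "poly_map F \<Longrightarrow> poly_map G \<Longrightarrow> poly_map (\<lambda>t. F t + G t)"

lemma poly_map_scale:
  fixes F :: "'k \<Rightarrow> 'a"
  shows "poly_map F \<Longrightarrow> poly_map (\<lambda>t. scale c (F t))"
proof (induction rule: poly_map.induct)
  case (shift F)
  from shift.IH have "poly_map (\<lambda>t. scale t (scale c (F t)))" by (rule poly_map.shift)
  then show ?case by (simp add: mult.commute)
qed (simp_all add: scale_right_distrib poly_map.intros)

text \<open>A linear functional carries questions about vector-valued polynomials to ordinary ones.\<close>
lemma poly_map_functional: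
  assumes f: "Vector_Spaces.linear scale (*) f"
  shows "poly_map F \<Longrightarrow> \<exists>p. \<forall>t. f (F t) = poly p t"
proof (induction rule: poly_map.induct)
  case (const v)
  have "\<forall>t. f v = poly [:f v:] t" by simp
  then show ?case by blast
next
  case (shift F)
  then obtain p where "\<forall>t. f (F t) = poly p t" by blast
  then have "\<forall>t. f (scale t (F t)) = poly (pCons 0 p) t" using f by (simp add: Vector_Spaces.linear_iff)
  then show ?case by blast
next
  case (add F G)
  then obtain p q where "\<forall>t. f (F t) = poly p t" "\<forall>t. f (G t) = poly q t" by blast
  then have "\<forall>t. f (F t + G t) = poly (p + q) t" using f by (simp add: Vector_Spaces.linear_iff)
  then show ?case by blast
qed

text \<open>First-order expansion at 0: \<open>F t = u + t v + O(t\<^sup>2)\<close>.\<close>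
definition has_jet :: "('k \<Rightarrow> 'a) \<Rightarrow> 'a \<Rightarrow> 'a \<Rightarrow> bool" where
  "has_jet F u v \<longleftrightarrow>
     (\<exists>R. poly_map R \<and> (\<forall>t. F t = u + scale t v + scale t (scale t (R t))))"

lemma has_jet_line: "has_jet (\<lambda>t. u + scale t v) u v"
  unfolding has_jet_def by (rule exI[of _ "\<lambda>t. 0"]) (simp add: poly_map.const)

lemma has_jet_add:
  assumes "has_jet F u v" "has_jet G u' v'"
  shows "has_jet (\<lambda>t. F t + G t) (u + u') (v + v')"
proof -
  from assms obtain R S where "poly_map R" "\<forall>t. F t = u + scale t v + scale t (scale t (R t))"
    "poly_map S" "\<forall>t. G t = u' + scale t v' + scale t (scale t (S t))"
    unfolding has_jet_def by blast
  then show ?thesis unfolding has_jet_def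
    by (intro exI[of _ "\<lambda>t. R t + S t"]) (simp add: poly_map.add scale_right_distrib ac_simps)
qed

lemma has_jet_scale:
  assumes "has_jet F u v"
  shows "has_jet (\<lambda>t. scale c (F t)) (scale c u) (scale c v)"
proof -
  from assms obtain R where "poly_map R" "\<forall>t. F t = u + scale t v + scale t (scale t (R t))"
    unfolding has_jet_def by blast
  then show ?thesis unfolding has_jet_def
    by (intro exI[of _ "\<lambda>t. scale c (R t)"])
      (simp add: poly_map_scale scale_right_distrib mult_ac)
qed

text \<open>Linear functionals separate points, and turn a vanishing polynomial map into a polynomial
  with infinitely many roots.\<close>
lemma has_jet_zero:
  assumes jet: "has_jet (\<lambda>t. 0) u v" and inf: "infinite (UNIV :: 'k set)"
  shows "v = 0"
proof (rule ccontr)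
  assume "v \<noteq> 0"
  then obtain f where f: "Vector_Spaces.linear scale (*) f" and fv: "f v \<noteq> 0"
    using functional_nonzero by blast
  interpret f: Vector_Spaces.linear scale "(*)" f by fact
  from jet obtain R where R: "poly_map R"
    and eq: "\<forall>t. 0 = u + scale t v + scale t (scale t (R t))"
    unfolding has_jet_def by (elim exE conjE) (rule that)
  from poly_map_functional[OF f R] obtain p where p: "\<forall>t. f (R t) = poly p t" by blast
  let ?q = "pCons (f u) (pCons (f v) p)"
  have "poly ?q t = 0" for t
  proof -
    have "f (u + scale t v + scale t (scale t (R t))) = f 0"
      by (rule arg_cong[OF eq[rule_format, symmetric]])
    then have "f u + t * f v + t * (t * poly p t) = 0" by (simp only: f.add f.scale p f.zero)
    then show ?thesis by (simp add: distrib_left add.assoc)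
  qed
  then have "{t. poly ?q t = 0} = UNIV" by blast
  with inf have "infinite {t. poly ?q t = 0}" by simp
  with poly_roots_finite[of ?q] have "?q = 0" by blast
  with fv show False by simp
qed

end

section \<open>The identity at an idempotent\<close>

context baric_algebra
begin

lemma mul_add_right: "mul x (y + z) = mul x y + mul x z"
  and mul_scale_right: "mul x (scale c y) = scale c (mul x y)"
  using mul_linear[of x] by (auto simp: Vector_Spaces.linear_iff)

lemma mul_add_left: "mul (x + y) z = mul x z + mul y z"
  and mul_scale_left: "mul (scale c x) z = scale c (mul x z)"
  by (simp_all add: mul_commute[of _ z] mul_add_right mul_scale_right)

lemma weight_add: "weight (x + y) = weight x + weight y"
  and weight_scale: "weight (scale c x) = c * weight x"
  using weight_linear by (auto simp: Vector_Spaces.linear_iff)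

lemma subspace_weight_kernel: "subspace {x. weight x = 0}"
  using weight_scale[of 0 0] by (auto simp: subspace_def weight_add weight_scale)

lemma poly_map_mul:
  assumes "poly_map F" "poly_map G"
  shows "poly_map (\<lambda>t. mul (F t) (G t))"
  using assms(1)
proof (induction rule: poly_map.induct)
  case (const v)
  from assms(2) show ?case
    by (induction rule: poly_map.induct)
      (simp_all add: mul_add_right mul_scale_right poly_map.intros)
qed (simp_all add: mul_add_left mul_scale_left poly_map.intros)

lemma has_jet_mul:
  assumes "has_jet F u v" "has_jet G u' v'"
  shows "has_jet (\<lambda>t. mul (F t) (G t)) (mul u u') (mul u v' + mul v u')"
proof -
  from assms obtain R S where R: "poly_map R" "\<forall>t. F t = u + scale t v + scale t (scale t (R t))"
    and S: "poly_map S" "\<forall>t. G t = u' + scale t v' + scale t (scale t (S t))"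
    unfolding has_jet_def by blast
  let ?Q = "\<lambda>t. (mul v v' + (mul u (S t) + mul (R t) u'))
    + scale t ((mul v (S t) + mul (R t) v') + scale t (mul (R t) (S t)))"
  have "poly_map ?Q" using R(1) S(1) by (intro poly_map.intros poly_map_mul)
  moreover have "mul (F t) (G t) = mul u u' + scale t (mul u v' + mul v u')
      + scale t (scale t (?Q t))" for t
    by (simp add: R(2) S(2) mul_add_left mul_add_right mul_scale_left mul_scale_right
        scale_right_distrib algebra_simps)
  ultimately show ?thesis unfolding has_jet_def by blast
qed

lemma principal_power_2: "principal_power mul x 2 = mul x x"
  and principal_power_4: "principal_power mul x 4 = mul x (mul x (mul x x))"
  by (simp_all add: principal_power_def numeral_eq_Suc)

text \<open>If \<open>e\<close> had weight 0, the right-hand side of the identity would vanish, while the left-hand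
  side is \<open>2 e\<close>.\<close>
lemma weight_idempotent:
  assumes id: "scale 2 (mul (principal_power mul e 2) (principal_power mul e 4)) =
        scale (weight e ^ 2) (principal_power mul e 4)
        + scale (weight e ^ 4) (principal_power mul e 2)"
    and e: "mul e e = e" "e \<noteq> 0" and two: "(2::'k) \<noteq> 0"
  shows "weight e = 1"
proof -
  have "weight e = weight e * weight e" using weight_mul[of e e] e by simp
  moreover have "weight e \<noteq> 0"
    using id e two by (auto simp: principal_power_2 principal_power_4)
  ultimately show ?thesis by simp
qed

text \<open>All points \<open>e + t y\<close> have weight 1, so along this line the identity has constant coefficients
  and compares two polynomial maps in \<open>t\<close>. Its first-order coefficient is the claim.\<close>
lemma linearized_identity:
  assumes id: "\<And>x. scale 2 (mul (principal_power mul x 2) (principal_power mul x 4)) =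
        scale (weight x ^ 2) (principal_power mul x 4)
        + scale (weight x ^ 4) (principal_power mul x 2)"
    and e: "mul e e = e" "weight e = 1" and y: "weight y = 0"
    and inf: "infinite (UNIV :: 'k set)"
  shows "scale 4 (mul e (mul e (mul e (mul e y)))) + scale 5 (mul e (mul e y))
    - scale 3 (mul e y) = 0"
proof -
  have two: "scale 2 v = v + v" and three: "scale 3 v = v + v + v"
    and four: "scale 4 v = v + v + v + v" and five: "scale 5 v = v + v + v + v + v" for v
    using scale_left_distrib[of 1 1 v] scale_left_distrib[of 2 1 v]
      scale_left_distrib[of 3 1 v] scale_left_distrib[of 4 1 v] by simp_all
  let ?x = "\<lambda>t. e + scale t y"
  note jet1 = has_jet_line[of e y]
  note jet2 = has_jet_mul[OF jet1 jet1]
  note jet4 = has_jet_mul[OF jet1 has_jet_mul[OF jet1 jet2]]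
  note jet = has_jet_add[OF has_jet_scale[OF has_jet_mul[OF jet2 jet4], of 2]
      has_jet_scale[OF has_jet_add[OF jet4 jet2], of "-1"]]
  have "scale 2 (mul (mul (?x t) (?x t)) (mul (?x t) (mul (?x t) (mul (?x t) (?x t)))))
      + scale (- 1) (mul (?x t) (mul (?x t) (mul (?x t) (?x t))) + mul (?x t) (?x t)) = 0" for t
  proof -
    define x where "x = ?x t"
    have "weight x = 1" using e y by (simp add: x_def weight_add weight_scale)
    with id[of x] show ?thesis
      by (simp add: principal_power_2 principal_power_4 flip: x_def)
  qed
  note jet = jet[unfolded this]
  \<comment> \<open>Folding multiplication by \<open>e\<close> into one symbol keeps commutativity out of the rewriting.\<close>
  define L where "L = mul e"
  have L: "mul e v = L v" "mul v e = L v" "L (v + w) = L v + L w" for v w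
    by (simp_all add: L_def mul_add_right mul_commute[of v])
  have Le: "L e = e" using e by (simp add: L_def)
  have "scale 4 (L (L (L (L y)))) + scale 5 (L (L y)) - scale 3 (L y) = 0"
    by (rule has_jet_zero[OF _ inf], rule back_subst[where P = "has_jet _ _", OF jet])
      (simp add: L Le two three four five)
  then show ?thesis by (simp add: L)
qed

end

section \<open>The Peirce eigenvalues and the decomposition\<close>

text \<open>\<open>(-1 - s)/4\<close> and \<open>(-1 + s)/4\<close> differ by \<open>s/2\<close>, which is where 23 enters. A coincidence with
  0 makes \<open>s\<^sup>2 = 1\<close>, so 24 = 0, which is where 3 enters; a coincidence with \<open>1/2\<close> makes
  \<open>s\<^sup>2 = 9\<close>, so 32 = 0.\<close>
lemma eigenvalues_distinct:
  fixes s :: "'k::field"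
  assumes char: "CHAR('k) \<noteq> 2" "CHAR('k) \<noteq> 3" "CHAR('k) \<noteq> 23" and s: "s ^ 2 = -23"
  shows "distinct [0, 1 / 2, (- 1 - s) / 4, (- 1 + s) / 4]"
proof -
  have nz: "of_nat p \<noteq> (0::'k)" if "prime p" "CHAR('k) \<noteq> p" for p
    using that by (metis CHAR_not_1' One_nat_def of_nat_eq_0_iff_char_dvd prime_nat_iff)
  have two: "(2::'k) \<noteq> 0" using nz[of 2] char by simp
  have three: "(3::'k) \<noteq> 0" using nz[of 3] char by simp
  have "prime (23::nat)" by simp
  then have twentythree: "(23::'k) \<noteq> 0" using nz[of 23] char by simp
  have nine: "(9::'k) \<noteq> - 23"
  proof
    assume "(9::'k) = - 23"
    then have "(2::'k) ^ 5 = 0" by (simp add: eq_neg_iff_add_eq_0)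
    with power_not_zero[OF two] show False by blast
  qed
  have one: "(1::'k) \<noteq> - 23"
  proof
    assume "(1::'k) = - 23"
    then have "(2::'k) ^ 3 * 3 = 0" by (simp add: eq_neg_iff_add_eq_0)
    with power_not_zero[OF two] three show False by (metis mult_eq_0_iff)
  qed
  have four: "(4::'k) \<noteq> 0" using two by (metis mult_2_right numeral_Bit0 mult_eq_0_iff)
  have s0: "s \<noteq> 0" and s1: "s \<noteq> 1" "s \<noteq> - 1" and s3: "s \<noteq> 3" "s \<noteq> - 3"
    using s twentythree one nine by auto
  have "(- 1 - s) / 4 \<noteq> 0" "(- 1 + s) / 4 \<noteq> 0"
    using s1 four by (auto simp: eq_neg_iff_add_eq_0 add.commute)
  moreover have "(- 1 - s) / 4 \<noteq> 1 / 2"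
  proof
    assume "(- 1 - s) / 4 = 1 / 2"
    then have "2 * (s + 3) = 0" using two four by (simp add: field_simps)
    with two have "s + 3 = 0" by (metis mult_eq_0_iff)
    with s3 show False by (simp add: eq_neg_iff_add_eq_0)
  qed
  moreover have "(- 1 + s) / 4 \<noteq> 1 / 2"
  proof
    assume "(- 1 + s) / 4 = 1 / 2"
    then have "2 * (s - 3) = 0" using two four by (simp add: field_simps)
    with two have "s - 3 = 0" by (metis mult_eq_0_iff)
    with s3 show False by simp
  qed
  moreover have "(- 1 - s) / 4 \<noteq> (- 1 + s) / 4"
  proof
    assume "(- 1 - s) / 4 = (- 1 + s) / 4"
    then have "2 * s = 0" using four by (simp add: field_simps)
    with s0 two show False by simp
  qed
  ultimately show ?thesis using two by auto
qed

theorem theorem3p2: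
  fixes scale :: "'k::alg_closed_field \<Rightarrow> 'a::ab_group_add \<Rightarrow> 'a"
    and mul :: "'a \<Rightarrow> 'a \<Rightarrow> 'a"
    and \<omega> :: "'a \<Rightarrow> 'k"
    and i_sqrt23 lam lam_bar :: 'k
    and e :: 'a
  assumes char: "CHAR('k) \<noteq> 2" "CHAR('k) \<noteq> 3" "CHAR('k) \<noteq> 23"
    and i_sqrt23: "i_sqrt23 ^ 2 = -23"
    and lam: "lam = (- 1 - i_sqrt23) / 4"
    and lam_bar: "lam_bar = (- 1 + i_sqrt23) / 4"
    and baric: "baric_algebra scale mul \<omega>"
    and identity: "\<And>x. scale 2 (mul (principal_power mul x 2) (principal_power mul x 4)) =
        scale (\<omega> x ^ 2) (principal_power mul x 4) + scale (\<omega> x ^ 4) (principal_power mul x 2)"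
    and idempotent: "mul e e = e" "e \<noteq> 0"
  shows "module.is_direct_sum scale
    [module.span scale {e},
     peirce_space scale mul \<omega> e 0,
     peirce_space scale mul \<omega> e (1 / 2),
     peirce_space scale mul \<omega> e lam,
     peirce_space scale mul \<omega> e lam_bar]"
proof -
  interpret baric_algebra scale mul \<omega> by fact
  let ?as = "[0, 1 / 2, lam, lam_bar]" and ?W = "{x. \<omega> x = 0}"
  let ?E = "peirce_space scale mul \<omega> e"
  have distinct: "distinct ?as"
    unfolding lam lam_bar using char i_sqrt23 by (rule eigenvalues_distinct)
  have two: "(2::'k) \<noteq> 0"
    using distinct by auto
  then have four: "(4::'k) \<noteq> 0" by (metis mult_2_right numeral_Bit0 mult_eq_0_iff)
  have vieta: "2 * (lam + lam_bar) = - 1" "2 * (lam * lam_bar) = 3"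
  proof -
    have 1: "4 * lam = - 1 - i_sqrt23" "4 * lam_bar = - 1 + i_sqrt23"
      using four by (simp_all add: lam lam_bar)
    have "2 * (2 * (lam + lam_bar)) = 4 * lam + 4 * lam_bar" by (simp add: algebra_simps)
    also have "\<dots> = 2 * (- 1)" unfolding 1 by simp
    finally show "2 * (lam + lam_bar) = - 1" using two by (simp only: mult_cancel_left) simp
    have "8 * (2 * (lam * lam_bar)) = (4 * lam) * (4 * lam_bar)" by simp
    also have "\<dots> = 1 - i_sqrt23 ^ 2" unfolding 1 by (simp add: algebra_simps power2_eq_square)
    also have "\<dots> = (2 * 4) * 3" unfolding i_sqrt23 by simp
    finally have "(2 * 4) * (2 * (lam * lam_bar)) = (2 * 4) * 3" by simp
    then show "2 * (lam * lam_bar) = 3" using two four by (metis mult_cancel_left mult_eq_0_iff)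
  qed
  have e1: "\<omega> e = 1" using identity idempotent two by (rule weight_idempotent)
  have all: "list_all2 (\<in>) vs (map ?E as) \<longleftrightarrow>
      list_all2 (\<lambda>v a. v \<in> ?W \<and> mul e v = scale a v) vs as" for vs as
    by (simp add: list_all2_map2 peirce_space_def)
  have kernel: "\<exists>vs. list_all2 (\<in>) vs (map ?E ?as) \<and> y = sum_list vs" if y: "\<omega> y = 0" for y
    unfolding all
  proof (rule eigenvectors_span[OF mul_linear subspace_weight_kernel _ distinct])
    interpret L: Vector_Spaces.linear scale scale "mul e" by (rule mul_linear)
    \<comment> \<open>Doubling the linear factor for \<open>1/2\<close> and the quadratic one keeps all coefficients integral.\<close>
    let ?Q = "\<lambda>z. mul e (mul e z - scale lam z) - scale lam_bar (mul e z - scale lam z)"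
    let ?z = "mul e (mul e y) - scale (1 / 2) (mul e y)"
    have Q: "scale 2 (?Q z) = scale 2 (mul e (mul e z)) + mul e z + scale 3 z" for z
    proof -
      have "?Q z = mul e (mul e z) - scale (lam + lam_bar) (mul e z) + scale (lam * lam_bar) z"
        by (simp add: L.diff L.scale scale_left_distrib scale_right_diff_distrib mult.commute)
      then have "scale 2 (?Q z) = scale 2 (mul e (mul e z))
          - scale (2 * (lam + lam_bar)) (mul e z) + scale (2 * (lam * lam_bar)) z"
        by (simp only: scale_right_distrib scale_right_diff_distrib scale_scale)
      then show ?thesis by (simp only: vieta scale_minus_left scale_one diff_minus_eq_add)
    qed
    have z: "scale 2 ?z = scale 2 (mul e (mul e y)) - mul e y"
      using two by (simp add: scale_right_diff_distrib)
    have "scale 2 (scale 2 (?Q ?z)) =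
        scale 2 (mul e (mul e (scale 2 ?z))) + mul e (scale 2 ?z) + scale 3 (scale 2 ?z)"
      by (simp only: Q scale_right_distrib L.scale scale_scale mult.commute)
    also have "\<dots> = scale 4 (mul e (mul e (mul e (mul e y)))) + scale 5 (mul e (mul e y))
        - scale 3 (mul e y)"
    proof -
      have "scale 6 v = scale 5 v + v" for v using scale_left_distrib[of 5 1 v] by simp
      then show ?thesis
        unfolding z by (simp add: L.diff L.scale scale_right_diff_distrib)
    qed
    also have "\<dots> = 0"
      using identity idempotent(1) e1 y infinite_UNIV_alg_closed by (rule linearized_identity)
    finally have "?Q ?z = 0" using two by (simp only: scale_eq_0_iff simp_thms)
    then show "fold (\<lambda>a z. mul e z - scale a z) ?as y = 0" by (simp add: L.scale)
  qed (use y in \<open>auto simp: weight_mul\<close>)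
  have "is_direct_sum (span {e} # map ?E ?as)"
  proof (rule is_direct_sumI)
    fix V assume "V \<in> set (span {e} # map ?E ?as)"
    moreover have "subspace (?E a)" for a
      using weight_scale[of 0 0] mul_scale_right[of e 0 0]
      by (auto simp: subspace_def peirce_space_def weight_add weight_scale mul_add_right
          mul_scale_right scale_right_distrib mult.commute)
    ultimately show "subspace V" by auto
  next
    fix x
    have "\<omega> (x + scale (- \<omega> x) e) = 0" by (simp only: weight_add weight_scale e1) simp
    from kernel[OF this] obtain vs where "list_all2 (\<in>) vs (map ?E ?as)"
      "x + scale (- \<omega> x) e = sum_list vs" by blast
    then show "\<exists>vs. list_all2 (\<in>) vs (span {e} # map ?E ?as) \<and> x = sum_list vs"
      by (intro exI[of _ "scale (\<omega> x) e # vs"])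
        (auto simp: span_scale span_base algebra_simps simp del: list.map)
  next
    fix us assume us: "list_all2 (\<in>) us (span {e} # map ?E ?as)" and sum0: "sum_list us = 0"
    then obtain u vs where u: "us = u # vs" "u \<in> span {e}" and vs: "list_all2 (\<in>) vs (map ?E ?as)"
      by (auto simp: list_all2_Cons2 simp del: list.map)
    from u obtain c where c: "u = scale c e" by (auto simp: span_singleton)
    have eig: "list_all2 (\<lambda>v a. v \<in> ?W \<and> mul e v = scale a v) vs ?as" using vs all by blast
    \<comment> \<open>The weight reads off the component along \<open>e\<close>.\<close>
    have "\<omega> (sum_list vs) = 0"
      if "list_all2 (\<lambda>v a. v \<in> ?W \<and> mul e v = scale a v) vs as" for vs as
      using that weight_scale[of 0 0] by (induction rule: list_all2_induct) (auto simp: weight_add)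
    from this[OF eig] have "\<omega> (sum_list us) = c"
      by (simp add: u c weight_add weight_scale e1)
    with sum0 weight_scale[of 0 0] have "c = 0" by simp
    with u c sum0 have u0: "u = 0" "sum_list vs = 0" by simp_all
    have "list_all2 (\<lambda>v a. mul e v = scale a v) vs ?as"
      by (rule list_all2_mono[OF eig]) simp
    from eigenvectors_independent[OF mul_linear distinct this u0(2)] u u0
    show "set us \<subseteq> {0}" by simp
  qed
  then show ?thesis by simp
qed

end
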